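(* Let $F$ be a continuous probability distribution function on $\mathbb{R}$, $\overline{F}:=1-F$, let $q\in\mathbb{R}$ and $\varepsilon>0$, and let $Y(1),Y(2),\dots$ be the $\{0,1\}$-valued process with parameters $(F,q,\varepsilon)$ defined in the context. For each integer $m\ge 1$ let $B_m:=Y(1)+\dots+Y(m)$. Let $n\ge 3$ be an integer. Then: 1. $\mathbb{P}[B_n=0]=\mathbb{P}[B_{n-1}=0]\,F\left(1-q+(n-1)\varepsilon\right)$; 2. $\mathbb{P}[B_n=n]=\mathbb{P}[B_{n-1}=n-1]\,\overline{F}\left(1-q-(n-1)\varepsilon\right)$; 3. for every integer $k$ with $1\le k\le n-1$, $$\mathbb{P}[B_n=k]=\mathbb{P}[B_{n-1}=k]\,F\left(1-q+(n-1-2k)\varepsilon\right)+\mathbb{P}[B_{n-1}=k-1]\,\overline{F}\left(1-q+(n-1-2(k-1))\varepsilon\right).$$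
   Context: A student attends a sequence of sessions; $Y(j)=1$ if session $j$ is understood and $Y(j)=0$ otherwise, and $B_m$ is the number of understood sessions (not necessarily consecutive) among the first $m$. Here $q$ is the quality parameter and $\varepsilon>0$ the dependence parameter. The process is defined as follows: session 1 is understood with probability $\overline{F}(1-q)$, and each time a session is understood (respectively not understood) the argument of $\overline{F}$ used for the next session is decreased (respectively increased) by $\varepsilon$. That is, $\mathbb{P}[Y(1)=1]=\overline{F}(1-q)$ and, for all $j\ge 1$ and all $(x_1,\dots,x_j)\in\{0,1\}^j$ with $\mathbb{P}[Y(1)=x_1,\dots,Y(j)=x_j]>0$, $$\mathbb{P}\left[Y(j+1)=1\mid Y(1)=x_1,\dots,Y(j)=x_j\right]=\overline{F}\left(1-q+(j-2s)\varepsilon\right),\qquad s:=x_1+\dots+x_j.$$ *)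

theory Defs
  imports "HOL-Probability.Probability"
begin

definition survival :: "(real \<Rightarrow> real) \<Rightarrow> real \<Rightarrow> real" where
  "survival F t = 1 - F t"

text \<open>
  Sessions are numbered from 1; \<open>Y 0\<close> is unconstrained and never used. An outcome
  \<open>(x\<^sub>1, \<dots>, x\<^sub>j)\<close> of the first \<open>j\<close> sessions is the restriction of
  \<open>x :: nat \<Rightarrow> nat\<close> to \<open>{1..j}\<close>.
\<close>

locale session_process = prob_space M for M :: "'a measure" +
  fixes F :: "real \<Rightarrow> real" and q \<epsilon> :: real and Y :: "nat \<Rightarrow> 'a \<Rightarrow> nat"
  assumes Y_measurable:
    "\<And>j. 1 \<le> j \<Longrightarrow> Y j \<in> measurable M (count_space {0, 1})"
  and Y_first:
    "\<P>(\<omega> in M. Y 1 \<omega> = 1) = survival F (1 - q)"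
  and Y_next:
    "\<And>j x. 1 \<le> j \<Longrightarrow> (\<forall>i\<in>{1..j}. x i \<in> {0, 1}) \<Longrightarrow>
       \<P>(\<omega> in M. \<forall>i\<in>{1..j}. Y i \<omega> = x i) > 0 \<Longrightarrow>
       \<P>(\<omega> in M. Y (j + 1) \<omega> = 1 \<bar> \<forall>i\<in>{1..j}. Y i \<omega> = x i)
         = survival F (1 - q + (real j - 2 * real (\<Sum>i = 1..j. x i)) * \<epsilon>)"

definition understood_count :: "(nat \<Rightarrow> 'a \<Rightarrow> nat) \<Rightarrow> nat \<Rightarrow> 'a \<Rightarrow> nat" where
  "understood_count Y m \<omega> = (\<Sum>i = 1..m. Y i \<omega>)"

end

theory Submission
  imports Defs
begin

text \<open>
  The conditional law of the next session depends on the past \<open>(x\<^sub>1, \<dots>, x\<^sub>j)\<close> only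
  through \<open>x\<^sub>1 + \<dots> + x\<^sub>j\<close>. The event that \<open>s\<close> of the first \<open>j\<close> sessions are understood
  is the disjoint union of finitely many pasts, all giving the same conditional probability, so
  conditioning on the sum alone gives that same probability (lemma \<open>prob_count_and_next\<close>).
  In product form this holds for pasts of probability zero as well. So the count is a Markov chain
  that at each step moves up by one or stays put, and the three claims are the one-step
  decomposition of this chain (lemma \<open>prob_count_Suc\<close>); for a count of \<open>0\<close> or \<open>n\<close>, only one
  of the two moves is possible.
\<close>

context session_process
begin

lemma Y_range:
  assumes "1 \<le> j" "\<omega> \<in> space M"
  shows "Y j \<omega> = 0 \<or> Y j \<omega> = 1"
  using measurable_space[OF Y_measurable[OF assms(1)] assms(2)] by simp

lemma Y_random_variable:
  assumes "1 \<le> j"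
  shows "Y j \<in> measurable M (count_space UNIV)"
  using measurable_compose[OF Y_measurable[OF assms], of "\<lambda>y. y" "count_space UNIV"] by simp

lemma count_random_variable:
  "understood_count Y m \<in> measurable M (count_space UNIV)"
proof -
  have "(\<lambda>\<omega>. \<Sum>i\<in>{1..m}. Y i \<omega>) \<in> measurable M (count_space UNIV)"
    using Y_random_variable by (intro measurable_sum_nat) auto
  thus ?thesis by (simp add: understood_count_def[abs_def])
qed

lemma past_in_events:
  "{\<omega> \<in> space M. \<forall>i\<in>{1..j}. Y i \<omega> = x i} \<in> events"
proof (rule sets.sets_Collect_finite_All)
  fix i assume "i \<in> {1..j}"
  hence [measurable]: "Y i \<in> measurable M (count_space UNIV)" by (simp add: Y_random_variable)
  show "{\<omega> \<in> space M. Y i \<omega> = x i} \<in> events" by measurable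
qed simp_all

lemma count_le:
  assumes "\<omega> \<in> space M"
  shows "understood_count Y m \<omega> \<le> m"
proof -
  have "(\<Sum>i = 1..m. Y i \<omega>) \<le> (\<Sum>i = 1..m. 1)"
    using Y_range[OF _ assms] by (intro sum_mono) (metis atLeastAtMost_iff le_refl zero_le)
  thus ?thesis by (simp add: understood_count_def)
qed

lemma prob_past_and_next:
  assumes "1 \<le> j" "\<forall>i\<in>{1..j}. x i \<in> {0, 1}"
  shows "\<P>(\<omega> in M. (\<forall>i\<in>{1..j}. Y i \<omega> = x i) \<and> Y (Suc j) \<omega> = 1)
    = \<P>(\<omega> in M. \<forall>i\<in>{1..j}. Y i \<omega> = x i)
      * survival F (1 - q + (real j - 2 * real (\<Sum>i = 1..j. x i)) * \<epsilon>)"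
proof (cases "\<P>(\<omega> in M. \<forall>i\<in>{1..j}. Y i \<omega> = x i) > 0")
  case True
  from Y_next[OF assms True] show ?thesis
    using True by (simp add: cond_prob_def field_simps conj_commute)
next
  case False
  hence null: "\<P>(\<omega> in M. \<forall>i\<in>{1..j}. Y i \<omega> = x i) = 0"
    by (simp add: zero_less_measure_iff)
  have "\<P>(\<omega> in M. (\<forall>i\<in>{1..j}. Y i \<omega> = x i) \<and> Y (Suc j) \<omega> = 1)
      \<le> \<P>(\<omega> in M. \<forall>i\<in>{1..j}. Y i \<omega> = x i)"
    by (rule finite_measure_mono[OF _ past_in_events]) auto
  hence "\<P>(\<omega> in M. (\<forall>i\<in>{1..j}. Y i \<omega> = x i) \<and> Y (Suc j) \<omega> = 1) = 0"
    using null by (simp add: measure_le_0_iff)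
  thus ?thesis using null by simp
qed

text \<open>
  An event that fixes the count splits into the possible pasts with that count. Pasts are taken
  as extensional functions on \<open>{1..j}\<close>, so that there are finitely many and each outcome lies in
  exactly one of them.
\<close>

lemma prob_count_split:
  assumes "{\<omega> \<in> space M. R \<omega>} \<in> events"
  shows "\<P>(\<omega> in M. understood_count Y j \<omega> = s \<and> R \<omega>)
    = (\<Sum>x | x \<in> {1..j} \<rightarrow>\<^sub>E {0, 1} \<and> (\<Sum>i = 1..j. x i) = s.
        \<P>(\<omega> in M. (\<forall>i\<in>{1..j}. Y i \<omega> = x i) \<and> R \<omega>))"
proof -
  define S where "S = {x \<in> {1..j} \<rightarrow>\<^sub>E {0, 1 :: nat}. (\<Sum>i = 1..j. x i) = s}"
  define A where "A x = {\<omega> \<in> space M. (\<forall>i\<in>{1..j}. Y i \<omega> = x i) \<and> R \<omega>}" for x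
  have fin: "finite S" by (simp add: S_def finite_PiE)
  have meas: "A ` S \<subseteq> events"
    using past_in_events assms by (auto simp: A_def intro!: sets.sets_Collect_conj)
  have disj: "disjoint_family_on A S"
    unfolding disjoint_family_on_def
  proof (intro ballI impI)
    fix x y assume "x \<in> S" "y \<in> S" "x \<noteq> y"
    moreover have "x = y" if "\<omega> \<in> A x" "\<omega> \<in> A y" for \<omega>
      using \<open>x \<in> S\<close> \<open>y \<in> S\<close> that by (auto simp: S_def A_def intro: PiE_ext)
    ultimately show "A x \<inter> A y = {}" by blast
  qed
  have "{\<omega> \<in> space M. understood_count Y j \<omega> = s \<and> R \<omega>} = (\<Union>x\<in>S. A x)"
  proof (intro equalityI subsetI)
    fix \<omega> assume w: "\<omega> \<in> {\<omega> \<in> space M. understood_count Y j \<omega> = s \<and> R \<omega>}"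
    let ?x = "restrict (\<lambda>i. Y i \<omega>) {1..j}"
    have "?x \<in> S"
      using w Y_range[of _ \<omega>] by (auto simp: S_def understood_count_def)
    moreover have "\<omega> \<in> A ?x" using w by (auto simp: A_def)
    ultimately show "\<omega> \<in> (\<Union>x\<in>S. A x)" by blast
  next
    fix \<omega> assume "\<omega> \<in> (\<Union>x\<in>S. A x)"
    thus "\<omega> \<in> {\<omega> \<in> space M. understood_count Y j \<omega> = s \<and> R \<omega>}"
      by (auto simp: S_def A_def understood_count_def)
  qed
  thus ?thesis
    using finite_measure_finite_Union[OF fin meas disj] by (simp add: S_def A_def)
qed

text \<open>
  All pasts with the same count share one factor, which comes out of the sum over these pasts.
\<close>

lemma prob_count_and_next:
  assumes "1 \<le> j"
  shows "\<P>(\<omega> in M. understood_count Y j \<omega> = s \<and> Y (Suc j) \<omega> = 1)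
    = \<P>(\<omega> in M. understood_count Y j \<omega> = s)
      * survival F (1 - q + (real j - 2 * real s) * \<epsilon>)"
proof -
  have [measurable]: "Y (Suc j) \<in> measurable M (count_space UNIV)"
    by (simp add: Y_random_variable)
  have ev: "{\<omega> \<in> space M. Y (Suc j) \<omega> = 1} \<in> events" by measurable
  let ?S = "{x \<in> {1..j} \<rightarrow>\<^sub>E {0, 1}. (\<Sum>i = 1..j. x i) = s}"
  have "\<P>(\<omega> in M. understood_count Y j \<omega> = s \<and> Y (Suc j) \<omega> = 1)
      = (\<Sum>x\<in>?S. \<P>(\<omega> in M. (\<forall>i\<in>{1..j}. Y i \<omega> = x i) \<and> Y (Suc j) \<omega> = 1))"
    by (rule prob_count_split[OF ev])
  also have "\<dots> = (\<Sum>x\<in>?S. \<P>(\<omega> in M. \<forall>i\<in>{1..j}. Y i \<omega> = x i)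
      * survival F (1 - q + (real j - 2 * real s) * \<epsilon>))"
  proof (rule sum.cong[OF refl])
    fix x assume x: "x \<in> ?S"
    hence "\<forall>i\<in>{1..j}. x i \<in> {0, 1}" and "(\<Sum>i = 1..j. x i) = s"
      by (auto dest: PiE_mem)
    from prob_past_and_next[OF assms this(1), unfolded this(2)]
    show "\<P>(\<omega> in M. (\<forall>i\<in>{1..j}. Y i \<omega> = x i) \<and> Y (Suc j) \<omega> = 1)
      = \<P>(\<omega> in M. \<forall>i\<in>{1..j}. Y i \<omega> = x i)
        * survival F (1 - q + (real j - 2 * real s) * \<epsilon>)" .
  qed
  also have "\<dots> = \<P>(\<omega> in M. understood_count Y j \<omega> = s)
      * survival F (1 - q + (real j - 2 * real s) * \<epsilon>)"
    using prob_count_split[of "\<lambda>_. True" j s] by (simp add: sum_distrib_right)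
  finally show ?thesis .
qed

lemma prob_count_and_not_next:
  assumes "1 \<le> j"
  shows "\<P>(\<omega> in M. understood_count Y j \<omega> = s \<and> Y (Suc j) \<omega> = 0)
    = \<P>(\<omega> in M. understood_count Y j \<omega> = s) * F (1 - q + (real j - 2 * real s) * \<epsilon>)"
proof -
  have [measurable]: "Y (Suc j) \<in> measurable M (count_space UNIV)"
    "understood_count Y j \<in> measurable M (count_space UNIV)"
    by (simp_all add: Y_random_variable count_random_variable)
  have "\<P>(\<omega> in M. understood_count Y j \<omega> = s)
      = \<P>(\<omega> in M. understood_count Y j \<omega> = s \<and> Y (Suc j) \<omega> = 0)
      + \<P>(\<omega> in M. understood_count Y j \<omega> = s \<and> Y (Suc j) \<omega> = 1)"
    using Y_range[of "Suc j"]
    by (subst finite_measure_Union[symmetric]) (auto intro!: arg_cong[where f = prob])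
  thus ?thesis
    using prob_count_and_next[OF assms, of s] by (simp add: survival_def algebra_simps)
qed

text \<open>
  The one-step decomposition is stated for every \<open>k\<close>; at \<open>k = 0\<close> no move up leads to \<open>k\<close>,
  and the conjunct \<open>0 < k\<close> keeps the truncated \<open>k - 1\<close> from turning into \<open>0\<close>.
\<close>

lemma prob_count_Suc:
  assumes "1 \<le> j"
  shows "\<P>(\<omega> in M. understood_count Y (Suc j) \<omega> = k)
    = \<P>(\<omega> in M. understood_count Y j \<omega> = k) * F (1 - q + (real j - 2 * real k) * \<epsilon>)
    + (if 0 < k then \<P>(\<omega> in M. understood_count Y j \<omega> = k - 1)
        * survival F (1 - q + (real j - 2 * real (k - 1)) * \<epsilon>) else 0)"
proof -
  have [measurable]: "Y (Suc j) \<in> measurable M (count_space UNIV)"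
    "understood_count Y j \<in> measurable M (count_space UNIV)"
    by (simp_all add: Y_random_variable count_random_variable)
  have step: "understood_count Y (Suc j) \<omega> = understood_count Y j \<omega> + Y (Suc j) \<omega>" for \<omega>
    by (simp add: understood_count_def)
  have "\<P>(\<omega> in M. understood_count Y (Suc j) \<omega> = k)
      = \<P>(\<omega> in M. understood_count Y j \<omega> = k \<and> Y (Suc j) \<omega> = 0)
      + \<P>(\<omega> in M. 0 < k \<and> understood_count Y j \<omega> = k - 1 \<and> Y (Suc j) \<omega> = 1)"
  proof (subst finite_measure_Union[symmetric])
    have "understood_count Y (Suc j) \<omega> = k \<longleftrightarrow>
        understood_count Y j \<omega> = k \<and> Y (Suc j) \<omega> = 0 \<or>
        0 < k \<and> understood_count Y j \<omega> = k - 1 \<and> Y (Suc j) \<omega> = 1"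
      if "\<omega> \<in> space M" for \<omega>
      using Y_range[of "Suc j" \<omega>] that by (auto simp: step)
    thus "\<P>(\<omega> in M. understood_count Y (Suc j) \<omega> = k)
      = prob ({\<omega> \<in> space M. understood_count Y j \<omega> = k \<and> Y (Suc j) \<omega> = 0} \<union>
          {\<omega> \<in> space M. 0 < k \<and> understood_count Y j \<omega> = k - 1 \<and> Y (Suc j) \<omega> = 1})"
      by (intro arg_cong[where f = prob]) blast
  qed auto
  thus ?thesis
    using prob_count_and_next[OF assms, of "k - 1"] prob_count_and_not_next[OF assms, of k]
    by simp
qed

end

theorem theorem3p2:
  fixes M :: "'a measure" and D :: "real measure" and F :: "real \<Rightarrow> real"
    and q \<epsilon> :: real and Y :: "nat \<Rightarrow> 'a \<Rightarrow> nat" and B :: "nat \<Rightarrow> 'a \<Rightarrow> nat" and n :: nat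
  assumes "real_distribution D" and "F = cdf D"
    and "continuous_on UNIV F"
    and "\<epsilon> > 0"
    and "session_process M F q \<epsilon> Y"
    and "B = understood_count Y"
    and "n \<ge> 3"
  shows "\<P>(\<omega> in M. B n \<omega> = 0)
           = \<P>(\<omega> in M. B (n - 1) \<omega> = 0) * F (1 - q + (real n - 1) * \<epsilon>)
       \<and> \<P>(\<omega> in M. B n \<omega> = n)
           = \<P>(\<omega> in M. B (n - 1) \<omega> = n - 1) * survival F (1 - q - (real n - 1) * \<epsilon>)
       \<and> (\<forall>k. 1 \<le> k \<and> k \<le> n - 1 \<longrightarrow>
           \<P>(\<omega> in M. B n \<omega> = k)
             = \<P>(\<omega> in M. B (n - 1) \<omega> = k) * F (1 - q + (real n - 1 - 2 * real k) * \<epsilon>)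
             + \<P>(\<omega> in M. B (n - 1) \<omega> = k - 1)
                 * survival F (1 - q + (real n - 1 - 2 * (real k - 1)) * \<epsilon>))"
proof -
  interpret session_process M F q \<epsilon> Y by fact
  obtain j where n: "n = Suc j" and j: "1 \<le> j"
    using \<open>n \<ge> 3\<close> by (cases n) auto
  note step = prob_count_Suc[OF j, folded \<open>B = understood_count Y\<close>]
  have unreachable: "\<P>(\<omega> in M. B j \<omega> = Suc j) = 0"
  proof -
    have "{\<omega> \<in> space M. B j \<omega> = Suc j} = {}"
      using count_le[of _ j] \<open>B = understood_count Y\<close> by fastforce
    thus ?thesis by (simp only: measure_empty)
  qed
  have zero: "\<P>(\<omega> in M. B n \<omega> = 0)
      = \<P>(\<omega> in M. B (n - 1) \<omega> = 0) * F (1 - q + (real n - 1) * \<epsilon>)"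
    using step[of 0] by (simp add: n)
  have full: "\<P>(\<omega> in M. B n \<omega> = n)
      = \<P>(\<omega> in M. B (n - 1) \<omega> = n - 1) * survival F (1 - q - (real n - 1) * \<epsilon>)"
  proof -
    have "1 - q + (real j - 2 * real j) * \<epsilon> = 1 - q - real j * \<epsilon>"
      by (simp add: algebra_simps)
    thus ?thesis using step[of n] unreachable by (simp add: n)
  qed
  have between: "\<P>(\<omega> in M. B n \<omega> = k)
      = \<P>(\<omega> in M. B (n - 1) \<omega> = k) * F (1 - q + (real n - 1 - 2 * real k) * \<epsilon>)
      + \<P>(\<omega> in M. B (n - 1) \<omega> = k - 1)
          * survival F (1 - q + (real n - 1 - 2 * (real k - 1)) * \<epsilon>)"
    if "1 \<le> k" for k
    using step[of k] that by (simp add: n of_nat_diff)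
  show ?thesis using zero full between by blast
qed

end
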